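(* Let $m\ge 1$ and $n\ge 3$ be integers and let $C_n^{(m)}$ be the one-point union of $m$ cycle graphs $C_n$. Then $$\mathcal{L}(C_n^{(m)})=\left(2^{n-2}\right)^{m}\binom{(m-1)(n-1)}{\underbrace{n-1,\ldots,n-1}_{m-1\text{ times}}}\left(\binom{m(n-1)}{n-1}+m\binom{m(n-1)}{n-2}\right).$$
   Context: Let $H$ be a finite, connected, undirected graph with vertex set $V$. A random walk labeling of $H$ is a labeling of $V$ obtainable by the following process: (1) set $i=1$, choose any $v\in V$ and label $v$ with $i$; (2) as long as there are unlabeled vertices, choose a vertex $w$ adjacent to the current vertex $v$ and replace $v$ by $w$; if this new $v$ is not labeled, increase $i$ by $1$ and label $v$ with $i$. The number of different random walk labelings of $H$ is denoted by $\mathcal{L}(H)$. $C_n^{(m)}$ is the graph obtained from $m$ disjoint copies of the cycle graph $C_n$ on $n$ vertices by choosing one vertex in each copy and identifying all the chosen vertices to a single vertex (so it has $m(n-1)+1$ vertices). $\binom{N}{a_1,\ldots,a_r}=\frac{N!}{a_1!\cdots a_r!}$ with $a_1+\cdots+a_r=N$ is the multinomial coefficient (equal to $1$ when $N=r=0$). *)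

theory Defs
  imports "Graph_Theory.Graph_Theory"
begin

section \<open>Random walk labelings\<close>

text \<open>Undirected simple graphs are symmetric loop-free digraphs (\<^locale>\<open>pair_graph\<close>), so
  \<open>w\<close> is adjacent to \<open>v\<close> iff \<open>(v, w)\<close> is an arc.

  \<open>rw_state H v f i\<close>: the labeling process on \<open>H\<close> can be in the situation where the walk stands at
  \<open>v\<close>, the labels assigned so far are given by \<open>f\<close> (undefined at unlabeled vertices) and the
  counter has value \<open>i\<close>. Steps are made only as long as there are unlabeled vertices.\<close>

inductive rw_state :: "'a pair_pre_digraph \<Rightarrow> 'a \<Rightarrow> ('a \<rightharpoonup> nat) \<Rightarrow> nat \<Rightarrow> bool"
  for H :: "'a pair_pre_digraph"
where
  start: "v \<in> pverts H \<Longrightarrow> rw_state H v [v \<mapsto> 1] 1"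
| old: "rw_state H v f i \<Longrightarrow> \<exists>u\<in>pverts H. f u = None \<Longrightarrow> (v, w) \<in> parcs H \<Longrightarrow> f w \<noteq> None
    \<Longrightarrow> rw_state H w f i"
| new: "rw_state H v f i \<Longrightarrow> \<exists>u\<in>pverts H. f u = None \<Longrightarrow> (v, w) \<in> parcs H \<Longrightarrow> f w = None
    \<Longrightarrow> rw_state H w (f(w \<mapsto> i + 1)) (i + 1)"

definition random_walk_labelings :: "'a pair_pre_digraph \<Rightarrow> ('a \<rightharpoonup> nat) set" where
  "random_walk_labelings H = {f. dom f = pverts H \<and> (\<exists>v i. rw_state H v f i)}"

definition num_rw_labelings :: "'a pair_pre_digraph \<Rightarrow> nat" (\<open>\<L>\<close>) where
  "\<L> H = card (random_walk_labelings H)"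

section \<open>One-point unions of cycles\<close>

text \<open>The expected graph only for \<open>n \<ge> 3\<close>.\<close>

definition cycle_graph :: "nat \<Rightarrow> nat pair_pre_digraph" where
  "cycle_graph n = \<lparr> pverts = {0..<n},
     parcs = {(i, j). i < n \<and> j < n \<and> (j = (i + 1) mod n \<or> i = (j + 1) mod n)} \<rparr>"

text \<open>The pairs \<open>(k, x)\<close> with \<open>x\<close> a vertex of \<open>G k\<close> are the vertices of the disjoint union of the
  graphs \<open>G k\<close>; all the chosen vertices \<open>(k, b k)\<close> are identified to the single vertex \<open>None\<close>.\<close>

definition glue :: "('k \<Rightarrow> 'a) \<Rightarrow> 'k \<times> 'a \<Rightarrow> ('k \<times> 'a) option" where
  "glue b p = (if snd p = b (fst p) then None else Some p)"

definition one_point_union ::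
    "'k set \<Rightarrow> ('k \<Rightarrow> 'a pair_pre_digraph) \<Rightarrow> ('k \<Rightarrow> 'a) \<Rightarrow> ('k \<times> 'a) option pair_pre_digraph" where
  "one_point_union K G b = \<lparr>
     pverts = {glue b (k, x) | k x. k \<in> K \<and> x \<in> pverts (G k)},
     parcs = {(glue b (k, x), glue b (k, y)) | k x y. k \<in> K \<and> (x, y) \<in> parcs (G k)} \<rparr>"

text \<open>\<open>b k < n\<close> is the vertex chosen in the \<open>k\<close>-th copy of the cycle, \<open>k < m\<close>.\<close>

definition cycle_union :: "nat \<Rightarrow> nat \<Rightarrow> (nat \<Rightarrow> nat) \<Rightarrow> (nat \<times> nat) option pair_pre_digraph" where
  "cycle_union n m b = one_point_union {0..<m} (\<lambda>k. cycle_graph n) b"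

lemma pair_graph_cycle_graph:
  assumes "n \<ge> 3"
  shows "pair_graph (cycle_graph n)"
proof
  show "finite (parcs (cycle_graph n))"
    by (rule finite_subset[of _ "{0..<n} \<times> {0..<n}"]) (auto simp: cycle_graph_def)
  show "symmetric (with_proj (cycle_graph n))"
    by (auto simp: symmetric_def cycle_graph_def intro!: symI)
  show "fst e \<noteq> snd e" if "e \<in> parcs (cycle_graph n)" for e
    using that assms by (auto simp: cycle_graph_def mod_Suc split: if_splits)
qed (auto simp: cycle_graph_def)

lemma pair_graph_one_point_union:
  assumes "finite K" and "\<And>k. k \<in> K \<Longrightarrow> pair_graph (G k)"
  shows "pair_graph (one_point_union K G b)"
proof -
  let ?U = "one_point_union K G b"
  have V: "pverts ?U = (\<Union>k\<in>K. (\<lambda>x. glue b (k, x)) ` pverts (G k))"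
    by (auto simp: one_point_union_def)
  have A: "parcs ?U = (\<Union>k\<in>K. (\<lambda>(x, y). (glue b (k, x), glue b (k, y))) ` parcs (G k))"
    by (force simp: one_point_union_def)
  have fin: "finite (pverts (G k))" "finite (parcs (G k))" if "k \<in> K" for k
    using pair_fin_digraph.pair_finite_verts pair_fin_digraph.pair_finite_arcs
      assms(2)[OF that] by (auto simp: pair_graph_def pair_digraph_def)
  have wf: "x \<in> pverts (G k)" "y \<in> pverts (G k)" "x \<noteq> y" "(y, x) \<in> parcs (G k)"
    if "k \<in> K" "(x, y) \<in> parcs (G k)" for k x y
  proof -
    interpret pair_graph "G k" by (rule assms(2)[OF that(1)])
    show "x \<in> pverts (G k)" "y \<in> pverts (G k)" "x \<noteq> y" "(y, x) \<in> parcs (G k)"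
      using that(2) wellformed' pair_no_loops[OF that(2)] pair_sym_arcs
      by (auto simp: symmetric_def sym_def)
  qed
  show ?thesis
  proof
    show "finite (pverts ?U)" "finite (parcs ?U)"
      using assms(1) fin by (auto simp: V A)
    fix e assume "e \<in> parcs ?U"
    then obtain k x y where e: "e = (glue b (k, x), glue b (k, y))" "k \<in> K" "(x, y) \<in> parcs (G k)"
      by (auto simp: one_point_union_def)
    from wf(1,2)[OF e(2,3)] e(2) show "fst e \<in> pverts ?U" "snd e \<in> pverts ?U"
      by (auto simp: e(1) V)
    from wf(3)[OF e(2,3)] show "fst e \<noteq> snd e"
      by (auto simp: e(1) glue_def)
  next
    have "(v, u) \<in> parcs ?U" if "(u, v) \<in> parcs ?U" for u v
    proof -
      from that obtain k x y
        where *: "u = glue b (k, x)" "v = glue b (k, y)" "k \<in> K" "(x, y) \<in> parcs (G k)"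
        by (auto simp: one_point_union_def)
      with wf(4)[OF *(3,4)] show ?thesis
        by (auto simp: one_point_union_def)
    qed
    then show "symmetric (with_proj ?U)"
      by (auto simp: symmetric_def intro!: symI)
  qed
qed

lemma pair_graph_cycle_union: "n \<ge> 3 \<Longrightarrow> pair_graph (cycle_union n m b)"
  by (simp add: cycle_union_def pair_graph_one_point_union pair_graph_cycle_graph)

lemma card_verts_cycle_union:
  assumes "m \<ge> 1" and "\<And>k. k < m \<Longrightarrow> b k < n"
  shows "card (pverts (cycle_union n m b)) = m * (n - 1) + 1"
proof -
  let ?S = "SIGMA k:{0..<m}. {0..<n} - {b k}"
  have V: "pverts (cycle_union n m b) = glue b ` ({0..<m} \<times> {0..<n})"
    by (force simp: cycle_union_def one_point_union_def cycle_graph_def)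
  have "{0..<m} \<times> {0..<n} = (\<lambda>k. (k, b k)) ` {0..<m} \<union> ?S"
    using assms(2) by auto
  moreover have "glue b ` (\<lambda>k. (k, b k)) ` {0..<m} = {None}"
    using assms(1) by (force simp: glue_def image_iff)
  moreover have "glue b ` ?S = Some ` ?S"
    by (intro image_cong) (auto simp: glue_def)
  ultimately have "pverts (cycle_union n m b) = insert None (Some ` ?S)"
    by (simp only: V image_Un) simp
  moreover have "card ?S = m * (n - 1)"
    using assms(2) by (simp add: card_SigmaI)
  ultimately show ?thesis
    by (simp add: card_image)
qed

section \<open>Multinomial coefficients\<close>

text \<open>Meant for \<open>N = sum_list as\<close>, in which case the division is exact.\<close>

definition multinomial :: "nat \<Rightarrow> nat list \<Rightarrow> nat" where
  "multinomial N as = fact N div prod_list (map fact as)"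

lemma prod_list_fact_dvd: "prod_list (map fact as) dvd (fact (sum_list as) :: nat)"
proof (induction as)
  case (Cons a as)
  have "fact a * prod_list (map fact as) dvd fact a * (fact (sum_list as) :: nat)"
    using Cons by (rule mult_dvd_mono[OF dvd_refl])
  also have "\<dots> dvd fact (a + sum_list as)"
    by (rule fact_fact_dvd_fact)
  finally show ?case by simp
qed simp

end

theory Submission
  imports Defs
begin

text \<open>A random walk labeling is an ordering of the vertices in which every vertex but the first is
  adjacent to an earlier one, so the number of ways to continue a labeling depends only on the set
  \<open>S\<close> of labeled vertices, and it is the sum of the corresponding numbers for \<open>S \<union> {x}\<close> over all
  \<open>x\<close> in the boundary of \<open>S\<close>. If \<open>S\<close> contains the centre, then the unlabeled vertices form in the
  \<open>k\<close>-th cycle a path with some number \<open>a k\<close> of vertices that is eaten up from both ends, which gives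
  a multinomial coefficient times \<open>2 ^ (a k - 1)\<close> for each \<open>k\<close>. If it does not, \<open>S\<close> is an arc of one
  cycle, and the numbers summed over all arcs of a given length telescope by the hockey-stick
  identity.\<close>

section \<open>Labelings as growing vertex sequences\<close>

definition boundary :: "'a pair_pre_digraph \<Rightarrow> 'a set \<Rightarrow> 'a set" where
  "boundary H S = {x \<in> pverts H - S. \<exists>u\<in>S. (u, x) \<in> parcs H}"

text \<open>The walk's position is left out on purpose: between two new labels the walk can return
  to any labeled vertex, so only the labeled set restricts which vertex comes next.\<close>

primrec grows :: "'a pair_pre_digraph \<Rightarrow> 'a set \<Rightarrow> 'a list \<Rightarrow> bool" where
  "grows H S [] \<longleftrightarrow> True"
| "grows H S (x # xs) \<longleftrightarrow> x \<in> boundary H S \<and> grows H (insert x S) xs"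

definition completions :: "'a pair_pre_digraph \<Rightarrow> 'a set \<Rightarrow> 'a list set" where
  "completions H S = {xs. grows H S xs \<and> S \<union> set xs = pverts H}"

definition labeling_of :: "'a list \<Rightarrow> 'a \<rightharpoonup> nat" where
  "labeling_of xs = map_of (zip xs [1..<Suc (length xs)])"

lemma grows_append: "grows H S (xs @ ys) \<longleftrightarrow> grows H S xs \<and> grows H (S \<union> set xs) ys"
  by (induction xs arbitrary: S) auto

lemma growsD:
  assumes "grows H S xs"
  shows "distinct xs" "set xs \<inter> S = {}" "set xs \<subseteq> pverts H"
  using assms by (induction xs arbitrary: S) (auto simp: boundary_def)

lemma finite_completions:
  assumes "finite (pverts H)"
  shows "finite (completions H S)"
  by (rule finite_subset[OF _ finite_subset_distinct[OF assms]])
    (use growsD(1,3)[of H] in \<open>auto simp: completions_def\<close>)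

lemma completions_pverts: "completions H (pverts H) = {[]}"
proof -
  have "xs = []" if "grows H (pverts H) xs" for xs
    using that by (cases xs) (auto simp: boundary_def)
  then show ?thesis by (auto simp: completions_def)
qed

text \<open>Classify completions by their first vertex; \<open>S \<noteq> pverts H\<close> excludes
  the empty list, and different first vertices give disjoint classes. All later counts rest on this
  recursion.\<close>

lemma card_completions_boundary:
  assumes "finite (pverts H)" and "S \<noteq> pverts H"
  shows "card (completions H S) = (\<Sum>x\<in>boundary H S. card (completions H (insert x S)))"
proof -
  have "xs \<in> completions H S \<longleftrightarrow>
      xs \<in> (\<Union>x\<in>boundary H S. (#) x ` completions H (insert x S))" for xs
    using assms(2) by (cases xs) (simp_all add: completions_def image_iff)
  then have eq: "completions H S = (\<Union>x\<in>boundary H S. (#) x ` completions H (insert x S))"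
    by blast
  have "finite (boundary H S)"
    using assms(1) by (simp add: boundary_def)
  then show ?thesis
    unfolding eq using finite_completions[OF assms(1)]
    by (subst card_UN_disjoint) (auto simp: card_image)
qed

section \<open>Encoding vertex sequences as label functions\<close>

lemma dom_labeling_of: "dom (labeling_of xs) = set xs"
  by (simp add: labeling_of_def dom_map_of_zip del: upt_Suc)

lemma labeling_of_snoc:
  assumes "w \<notin> set xs"
  shows "labeling_of (xs @ [w]) = (labeling_of xs)(w \<mapsto> Suc (length xs))"
proof -
  have "[1..<Suc (length (xs @ [w]))] = [1..<Suc (length xs)] @ [Suc (length xs)]"
    by simp
  then have "labeling_of (xs @ [w]) = [w \<mapsto> Suc (length xs)] ++ labeling_of xs"
    by (simp add: labeling_of_def del: upt_Suc)
  also have "\<dots> = labeling_of xs ++ [w \<mapsto> Suc (length xs)]"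
    using assms by (intro map_add_comm) (simp add: dom_labeling_of)
  finally show ?thesis by simp
qed

lemma labeling_of_nth:
  assumes "distinct xs" and "i < length xs"
  shows "labeling_of xs (xs ! i) = Some (Suc i)"
  using map_of_zip_nth[of xs "[1..<Suc (length xs)]" i] assms
  by (simp add: labeling_of_def del: upt_Suc)

text \<open>Equal domains force equal lengths, and the label of a vertex in a distinct list
  determines its position.\<close>

lemma labeling_of_inject:
  assumes "distinct xs" "distinct ys" and eq: "labeling_of xs = labeling_of ys"
  shows "xs = ys"
proof -
  have sets: "set xs = set ys"
    using arg_cong[OF eq, of dom] by (simp add: dom_labeling_of)
  with assms have len: "length xs = length ys"
    by (metis distinct_card)
  show ?thesis
  proof (rule nth_equalityI[OF len])
    fix i assume i: "i < length xs"
    then obtain j where j: "j < length ys" "ys ! j = xs ! i"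
      using sets by (metis in_set_conv_nth nth_mem)
    have "Some (Suc i) = Some (Suc j)"
      using labeling_of_nth[OF assms(1) i] labeling_of_nth[OF assms(2) j(1)] eq j(2) by simp
    with j show "xs ! i = ys ! i" by simp
  qed
qed

section \<open>Random walks versus growing sequences\<close>

context pair_graph
begin

text \<open>A step to a labeled vertex leaves the sequence alone, a step to an unlabeled one appends
  it. The invariant that \<open>v\<close> is listed puts the appended vertex into the
  boundary.\<close>

lemma rw_state_imp_grows:
  assumes "rw_state G v f i"
  shows "\<exists>x xs. x \<in> pverts G \<and> grows G {x} xs \<and> v \<in> set (x # xs)
    \<and> f = labeling_of (x # xs) \<and> i = length (x # xs)"
  using assms
proof induction
  case (start v)
  have "[v \<mapsto> 1] = labeling_of [v]"
    by (simp add: labeling_of_def)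
  with start show ?case
    by (intro exI[of _ v] exI[of _ "[]"]) simp
next
  case (old v f i w)
  then obtain x xs where *: "x \<in> pverts G" "grows G {x} xs" "f = labeling_of (x # xs)"
    "i = length (x # xs)"
    by blast
  moreover have "w \<in> set (x # xs)"
    using old.hyps(4) *(3) by (metis dom_labeling_of domIff)
  ultimately show ?case by blast
next
  case (new v f i w)
  then obtain x xs where *: "x \<in> pverts G" "grows G {x} xs" "v \<in> set (x # xs)"
    "f = labeling_of (x # xs)" "i = length (x # xs)"
    by blast
  have w: "w \<notin> set (x # xs)"
    using new.hyps(4) *(4) by (metis dom_labeling_of domIff)
  have "w \<in> boundary G (set (x # xs))"
    using w *(3) new.hyps(3) wellformed'(2)[OF new.hyps(3)] unfolding boundary_def by blast
  then have "grows G {x} (xs @ [w])"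
    using *(2) by (simp add: grows_append)
  moreover have "f(w \<mapsto> i + 1) = labeling_of (x # xs @ [w])"
    using labeling_of_snoc[OF w] *(4,5) by simp
  ultimately show ?case
    using *(1,5) by (intro exI[of _ x] exI[of _ "xs @ [w]"]) simp
qed

text \<open>Moves inside \<open>dom f\<close> are \<open>old\<close> steps, which the process
  permits only while some vertex is unlabeled.\<close>

lemma rw_state_rtrancl:
  assumes "(u, v) \<in> (parcs G \<inter> dom f \<times> dom f)\<^sup>*" and "rw_state G u f i"
    and "\<exists>y\<in>pverts G. f y = None"
  shows "rw_state G v f i"
  using assms(1) by (induction rule: rtrancl_induct) (use assms(2,3) in \<open>auto intro: rw_state.old\<close>)

text \<open>Each new vertex has an arc from an earlier one, and symmetry supplies the reverse arc;
  so the listed vertices stay mutually reachable without leaving the list.\<close>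

lemma grows_rtrancl:
  assumes "grows G {x} xs" "u \<in> set (x # xs)" "v \<in> set (x # xs)"
  shows "(u, v) \<in> (parcs G \<inter> set (x # xs) \<times> set (x # xs))\<^sup>*"
  using assms
proof (induction xs arbitrary: u v rule: rev_induct)
  case (snoc w xs)
  let ?R = "\<lambda>xs. (parcs G \<inter> set (x # xs) \<times> set (x # xs))\<^sup>*"
  have mono: "?R xs \<subseteq> ?R (xs @ [w])"
    by (intro rtrancl_mono) auto
  from snoc.prems(1) obtain y where y: "y \<in> set (x # xs)" "(y, w) \<in> parcs G"
    and g: "grows G {x} xs"
    by (auto simp: grows_append boundary_def)
  have "(w, y) \<in> parcs G"
    using y(2) pair_sym_arcs by (auto simp: symmetric_def sym_def)
  with y have wy: "(w, y) \<in> ?R (xs @ [w])" "(y, w) \<in> ?R (xs @ [w])"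
    by (auto intro!: r_into_rtrancl)
  have "(u, y) \<in> ?R (xs @ [w])"
    using snoc.IH[OF g _ y(1)] snoc.prems(2) wy mono by auto
  moreover have "(y, v) \<in> ?R (xs @ [w])"
    using snoc.IH[OF g y(1)] snoc.prems(3) wy mono by auto
  ultimately show ?case by (rule rtrancl_trans)
qed simp

text \<open>Before each new vertex the walk goes back, through labeled vertices only, to a labeled
  neighbour \<open>y\<close> of it and then steps across.\<close>

lemma grows_imp_rw_state:
  assumes "x \<in> pverts G" and "grows G {x} xs"
  shows "\<exists>v\<in>set (x # xs). rw_state G v (labeling_of (x # xs)) (length (x # xs))"
  using assms(2)
proof (induction xs rule: rev_induct)
  case Nil
  have "labeling_of [x] = [x \<mapsto> 1]"
    by (simp add: labeling_of_def)
  with rw_state.start[OF assms(1)] show ?case by (simp del: fun_upd_apply)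
next
  case (snoc w xs)
  let ?f = "labeling_of (x # xs)"
  from snoc.prems obtain y where y: "y \<in> set (x # xs)" "(y, w) \<in> parcs G"
    and w: "w \<notin> set (x # xs)" "w \<in> pverts G" and g: "grows G {x} xs"
    by (auto simp: grows_append boundary_def)
  have fw: "?f w = None"
    using w(1) by (metis dom_labeling_of domIff)
  with w(2) have unlabeled: "\<exists>u\<in>pverts G. ?f u = None" by blast
  from snoc.IH[OF g] obtain v
    where v: "v \<in> set (x # xs)" "rw_state G v ?f (length (x # xs))"
    by blast
  have "rw_state G y ?f (length (x # xs))"
    using rw_state_rtrancl[OF _ v(2) unlabeled] grows_rtrancl[OF g v(1) y(1)]
    by (simp only: dom_labeling_of)
  from rw_state.new[OF this unlabeled y(2) fw] labeling_of_snoc[OF w(1)] show ?case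
    by (intro bexI[of _ w]) (simp_all del: fun_upd_apply)
qed

lemma random_walk_labelings_eq:
  "random_walk_labelings G = labeling_of ` (\<Union>v\<in>pverts G. (#) v ` completions G {v})"
proof (intro set_eqI iffI)
  fix f assume "f \<in> random_walk_labelings G"
  then obtain v i where f: "dom f = pverts G" "rw_state G v f i"
    by (auto simp: random_walk_labelings_def)
  from rw_state_imp_grows[OF f(2)] obtain x xs
    where x: "x \<in> pverts G" "grows G {x} xs" "f = labeling_of (x # xs)"
    by blast
  then have "xs \<in> completions G {x}"
    using f(1) by (simp add: completions_def dom_labeling_of)
  with x show "f \<in> labeling_of ` (\<Union>v\<in>pverts G. (#) v ` completions G {v})"
    by blast
next
  fix f assume "f \<in> labeling_of ` (\<Union>v\<in>pverts G. (#) v ` completions G {v})"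
  then obtain x xs where "x \<in> pverts G" "xs \<in> completions G {x}" "f = labeling_of (x # xs)"
    by blast
  with grows_imp_rw_state[of x xs] show "f \<in> random_walk_labelings G"
    by (auto simp: random_walk_labelings_def completions_def dom_labeling_of)
qed

lemma num_rw_labelings_eq: "\<L> G = (\<Sum>v\<in>pverts G. card (completions G {v}))"
proof -
  have "distinct xs" if "xs \<in> (\<Union>v\<in>pverts G. (#) v ` completions G {v})" for xs
    using that growsD(1,2)[of G] by (fastforce simp: completions_def)
  then have "inj_on labeling_of (\<Union>v\<in>pverts G. (#) v ` completions G {v})"
    by (intro inj_onI labeling_of_inject)
  then have "\<L> G = card (\<Union>v\<in>pverts G. (#) v ` completions G {v})"
    by (simp add: num_rw_labelings_def random_walk_labelings_eq card_image)
  also have "\<dots> = (\<Sum>v\<in>pverts G. card (completions G {v}))"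
    using finite_completions[OF pair_finite_verts] by (subst card_UN_disjoint) (auto simp: card_image)
  finally show ?thesis .
qed

end

section \<open>The one-point union of cycles\<close>

locale cycle_coordinates =
  fixes m n :: nat and b :: "nat \<Rightarrow> nat"
  assumes m_pos: "m \<ge> 1" and n_ge_3: "n \<ge> 3" and base_less: "k < m \<Longrightarrow> b k < n"
begin

abbreviation H :: "(nat \<times> nat) option pair_pre_digraph" where
  "H \<equiv> cycle_union n m b"

text \<open>\<open>pt k 0, pt k 1, \<dots>, pt k n\<close> runs once around the \<open>k\<close>-th cycle, starting and ending at the
  centre \<open>None\<close>.\<close>

definition pt :: "nat \<Rightarrow> nat \<Rightarrow> (nat \<times> nat) option" where
  "pt k t = glue b (k, (b k + t) mod n)"

lemma mod_base:
  assumes "k < m" and "t < n"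
  shows "(b k + t) mod n = (if b k + t < n then b k + t else b k + t - n)"
  using base_less[OF assms(1)] assms(2) by (simp add: mod_if)

lemma pt_0 [simp]: "k < m \<Longrightarrow> pt k 0 = None"
  and pt_n [simp]: "k < m \<Longrightarrow> pt k n = None"
  using base_less by (auto simp: pt_def glue_def)

lemma pt_inner:
  assumes "k < m" "0 < t" "t < n"
  shows "pt k t = Some (k, (b k + t) mod n)"
  using mod_base[OF assms(1,3)] assms base_less[OF assms(1)]
  by (auto simp: pt_def glue_def split: if_splits)

text \<open>The parameters 0 and \<open>n\<close> both denote the centre, so uniqueness of
  coordinates holds at inner vertices. Letting \<open>t'\<close> be 0 or \<open>n\<close> makes the
  lemma also separate inner vertices from the centre.\<close>

lemma pt_eq_iff:
  assumes "k < m" "k' < m" "0 < t" "t < n" "t' \<le> n"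
  shows "pt k' t' = pt k t \<longleftrightarrow> k' = k \<and> t' = t"
proof (cases "0 < t' \<and> t' < n")
  case True
  then show ?thesis
    using assms mod_base[of k t] mod_base[of k t'] base_less[of k]
    by (auto simp: pt_inner split: if_splits)
next
  case False
  then have "t' = 0 \<or> t' = n" using assms(5) by auto
  then show ?thesis using assms by (auto simp: pt_inner)
qed

lemma glue_eq_pt:
  assumes "k < m" "x < n"
  obtains t where "t < n" "(b k + t) mod n = x" "glue b (k, x) = pt k t"
proof -
  \<comment> \<open>The offset of \<open>x\<close> from the chosen vertex \<open>b k\<close>,
    counted forwards with wrap-around.\<close>
  let ?t = "if b k \<le> x then x - b k else x + n - b k"
  have "?t < n" "(b k + ?t) mod n = x"
    using assms base_less[OF assms(1)] by auto
  then show ?thesis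
    using that by (simp add: pt_def)
qed

lemma pverts_H: "pverts H = {pt k t | k t. k < m \<and> t \<le> n}"
proof (intro set_eqI iffI)
  fix v assume "v \<in> pverts H"
  then obtain k x where "k < m" "x < n" "v = glue b (k, x)"
    by (auto simp: cycle_union_def one_point_union_def cycle_graph_def)
  moreover obtain t where "t < n" "glue b (k, x) = pt k t"
    using glue_eq_pt[OF \<open>k < m\<close> \<open>x < n\<close>] by metis
  ultimately show "v \<in> {pt k t | k t. k < m \<and> t \<le> n}"
    using less_imp_le_nat by blast
next
  fix v assume "v \<in> {pt k t | k t. k < m \<and> t \<le> n}"
  then obtain k t where "k < m" "v = glue b (k, (b k + t) mod n)"
    by (auto simp: pt_def)
  moreover have "(b k + t) mod n < n" for k t
    using n_ge_3 by simp
  ultimately show "v \<in> pverts H"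
    unfolding cycle_union_def one_point_union_def cycle_graph_def by auto
qed

lemma pt_in_pverts: "k < m \<Longrightarrow> t \<le> n \<Longrightarrow> pt k t \<in> pverts H"
  by (auto simp: pverts_H)

lemma None_in_pverts: "None \<in> pverts H"
  using pt_in_pverts[of 0 0] m_pos by simp

lemma pverts_cases:
  assumes "v \<in> pverts H"
  obtains "v = None" | k t where "k < m" "0 < t" "t < n" "v = pt k t"
proof -
  from assms obtain k t where kt: "k < m" "t \<le> n" "v = pt k t"
    by (auto simp: pverts_H)
  show ?thesis
    using that kt by (cases "t = 0 \<or> t = n") auto
qed

text \<open>Adding 1 modulo \<open>n\<close> in the cycle becomes passing from \<open>t\<close> to
  \<open>Suc t\<close>; the case \<open>Suc t = n\<close> closes the cycle at the centre.\<close>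

lemma parcs_H:
  "(u, v) \<in> parcs H \<longleftrightarrow>
    (\<exists>k<m. \<exists>t<n. u = pt k t \<and> v = pt k (Suc t) \<or> u = pt k (Suc t) \<and> v = pt k t)"
proof -
  have step: "glue b (k, (x + 1) mod n) = pt k (Suc t)"
    if "(b k + t) mod n = x" for k x t
    using that by (auto simp: pt_def mod_simps)
  have "(u, v) \<in> parcs H \<longleftrightarrow> (\<exists>k<m. \<exists>x<n.
      u = glue b (k, x) \<and> v = glue b (k, (x + 1) mod n)
      \<or> u = glue b (k, (x + 1) mod n) \<and> v = glue b (k, x))"
    using n_ge_3 by (force simp: cycle_union_def one_point_union_def cycle_graph_def)
  also have "\<dots> \<longleftrightarrow>
      (\<exists>k<m. \<exists>t<n. u = pt k t \<and> v = pt k (Suc t) \<or> u = pt k (Suc t) \<and> v = pt k t)"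
  proof (rule ex_cong1, rule conj_cong[OF refl], rule iffI)
    fix k assume k: "k < m"
    assume "\<exists>x<n. u = glue b (k, x) \<and> v = glue b (k, (x + 1) mod n)
      \<or> u = glue b (k, (x + 1) mod n) \<and> v = glue b (k, x)"
    then obtain x where x: "x < n" "u = glue b (k, x) \<and> v = glue b (k, (x + 1) mod n)
      \<or> u = glue b (k, (x + 1) mod n) \<and> v = glue b (k, x)"
      by blast
    obtain t where t: "t < n" "(b k + t) mod n = x" "glue b (k, x) = pt k t"
      using glue_eq_pt[OF k x(1)] .
    show "\<exists>t<n. u = pt k t \<and> v = pt k (Suc t) \<or> u = pt k (Suc t) \<and> v = pt k t"
      using x(2) t(1) unfolding step[OF t(2)] t(3) by blast
  next
    fix k assume k: "k < m"
    assume "\<exists>t<n. u = pt k t \<and> v = pt k (Suc t) \<or> u = pt k (Suc t) \<and> v = pt k t"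
    then obtain t where t: "u = pt k t \<and> v = pt k (Suc t) \<or> u = pt k (Suc t) \<and> v = pt k t"
      by blast
    let ?x = "(b k + t) mod n"
    have "?x < n" "pt k t = glue b (k, ?x)" using n_ge_3 by (auto simp: pt_def)
    with t show "\<exists>x<n. u = glue b (k, x) \<and> v = glue b (k, (x + 1) mod n)
      \<or> u = glue b (k, (x + 1) mod n) \<and> v = glue b (k, x)"
      unfolding step[of k t ?x, OF refl, symmetric] by blast
  qed
  finally show ?thesis .
qed

lemma neighbours_pt:
  assumes "k < m" "0 < t" "t < n"
  shows "(u, pt k t) \<in> parcs H \<longleftrightarrow> u = pt k (t - 1) \<or> u = pt k (Suc t)"
    and "(pt k t, u) \<in> parcs H \<longleftrightarrow> u = pt k (t - 1) \<or> u = pt k (Suc t)"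
proof -
  have *: "(\<exists>k'<m. \<exists>s<n. u = pt k' s \<and> pt k t = pt k' (Suc s)
      \<or> u = pt k' (Suc s) \<and> pt k t = pt k' s)
    \<longleftrightarrow> u = pt k (t - 1) \<or> u = pt k (Suc t)" (is "?L \<longleftrightarrow> ?R")
  proof
    assume ?L
    then obtain k' s where s: "k' < m" "s < n" and
      "u = pt k' s \<and> pt k t = pt k' (Suc s) \<or> u = pt k' (Suc s) \<and> pt k t = pt k' s"
      by blast
    from this(3) show ?R
    proof (elim disjE conjE)
      assume "u = pt k' s" "pt k t = pt k' (Suc s)"
      then show ?R
        using pt_eq_iff[of k k' t "Suc s", OF assms(1) s(1) assms(2,3)] s(2) by auto
    next
      assume "u = pt k' (Suc s)" "pt k t = pt k' s"
      then show ?R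
        using pt_eq_iff[of k k' t s, OF assms(1) s(1) assms(2,3)] s(2) by auto
    qed
  next
    assume ?R
    then show ?L
    proof
      assume "u = pt k (t - 1)"
      with assms show ?L by (intro exI[of _ k] exI[of _ "t - 1"] conjI) auto
    next
      assume "u = pt k (Suc t)"
      with assms show ?L by (intro exI[of _ k] exI[of _ t] conjI) auto
    qed
  qed
  from * show "(u, pt k t) \<in> parcs H \<longleftrightarrow> u = pt k (t - 1) \<or> u = pt k (Suc t)"
    unfolding parcs_H .
  from * show "(pt k t, u) \<in> parcs H \<longleftrightarrow> u = pt k (t - 1) \<or> u = pt k (Suc t)"
    unfolding parcs_H by blast
qed

section \<open>Counting completions once the centre is labeled\<close>

text \<open>The unlabeled vertices once the centre is labeled.\<close>

definition gaps :: "(nat \<Rightarrow> nat) \<Rightarrow> (nat \<Rightarrow> nat) \<Rightarrow> (nat \<times> nat) option set" where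
  "gaps lo hi = {pt k t | k t. k < m \<and> lo k < t \<and> t < hi k}"

text \<open>The bound \<open>hi k \<le> n\<close> keeps every gap inside the inner vertices, where
  coordinates are unique.\<close>

lemma pt_in_gaps_iff:
  assumes "\<And>k. k < m \<Longrightarrow> hi k \<le> n" and "k < m" "t \<le> n"
  shows "pt k t \<in> gaps lo hi \<longleftrightarrow> lo k < t \<and> t < hi k"
proof
  assume "pt k t \<in> gaps lo hi"
  then obtain k' t' where "k' < m" "lo k' < t'" "t' < hi k'" "pt k t = pt k' t'"
    by (auto simp: gaps_def)
  moreover from this have "t' < n" using assms(1)[of k'] by simp
  ultimately show "lo k < t \<and> t < hi k"
    using pt_eq_iff[of k' k t' t] assms(2,3) by simp
qed (use assms in \<open>auto simp: gaps_def\<close>)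

lemma None_notin_gaps:
  assumes "\<And>k. k < m \<Longrightarrow> hi k \<le> n"
  shows "None \<notin> gaps lo hi"
  using pt_in_gaps_iff[of hi 0 0 lo, OF assms] m_pos by simp

text \<open>Only the two ends of a gap have a neighbour outside it, since both neighbours of any
  other gap vertex lie in the gap. In a gap of one vertex the two ends coincide.\<close>

lemma boundary_gaps:
  assumes hi: "\<And>k. k < m \<Longrightarrow> hi k \<le> n"
  shows "boundary H (pverts H - gaps lo hi)
    = (\<Union>k<m. if Suc (lo k) < hi k then {pt k (Suc (lo k)), pt k (hi k - 1)} else {})"
    (is "_ = (\<Union>k<m. ?B k)")
proof (intro set_eqI iffI)
  fix x assume "x \<in> boundary H (pverts H - gaps lo hi)"
  then obtain u where x: "x \<in> gaps lo hi" and u: "u \<notin> gaps lo hi" "(u, x) \<in> parcs H"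
    by (auto simp: boundary_def)
  from x obtain k t where t: "k < m" "lo k < t" "t < hi k" "x = pt k t"
    by (auto simp: gaps_def)
  have "t < n" using t(1,3) hi[of k] by simp
  then have "u = pt k (t - 1) \<or> u = pt k (Suc t)"
    using neighbours_pt(1)[of k t u] t u(2) by auto
  then have "t = Suc (lo k) \<or> t = hi k - 1"
    using u(1) pt_in_gaps_iff[of hi k "t - 1" lo, OF hi] pt_in_gaps_iff[of hi k "Suc t" lo, OF hi]
      t \<open>t < n\<close> by auto
  then have "x \<in> ?B k"
    using t by auto
  with t(1) show "x \<in> (\<Union>k<m. ?B k)" by blast
next
  fix x assume "x \<in> (\<Union>k<m. ?B k)"
  then obtain k where k: "k < m" "Suc (lo k) < hi k" "x = pt k (Suc (lo k)) \<or> x = pt k (hi k - 1)"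
    by (auto split: if_splits)
  have n: "hi k \<le> n" using hi k(1) .
  from k(3) show "x \<in> boundary H (pverts H - gaps lo hi)"
  proof
    assume x: "x = pt k (Suc (lo k))"
    have "(pt k (lo k), x) \<in> parcs H"
      using neighbours_pt(1)[of k "Suc (lo k)"] k n x by auto
    then show ?thesis
      using pt_in_gaps_iff[of hi k "Suc (lo k)" lo, OF hi] pt_in_gaps_iff[of hi k "lo k" lo, OF hi] k n x
        pt_in_pverts[of k "lo k"] pt_in_pverts[of k "Suc (lo k)"]
      by (auto simp: boundary_def)
  next
    assume x: "x = pt k (hi k - 1)"
    have "(pt k (hi k), x) \<in> parcs H"
      using neighbours_pt(1)[of k "hi k - 1"] k n x by auto
    then show ?thesis
      using pt_in_gaps_iff[of hi k "hi k - 1" lo, OF hi] pt_in_gaps_iff[of hi k "hi k" lo, OF hi] k n x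
        pt_in_pverts[of k "hi k"] pt_in_pverts[of k "hi k - 1"]
      by (auto simp: boundary_def)
  qed
qed

lemma insert_lo_gaps:
  assumes hi: "\<And>k. k < m \<Longrightarrow> hi k \<le> n" and k: "k < m" "Suc (lo k) < hi k"
  shows "insert (pt k (Suc (lo k))) (pverts H - gaps lo hi)
    = pverts H - gaps (lo(k := Suc (lo k))) hi" (is "?L = ?R")
proof (intro set_eqI)
  fix x
  have n: "hi k \<le> n" using hi k(1) .
  show "x \<in> ?L \<longleftrightarrow> x \<in> ?R"
  proof (cases "x \<in> pverts H")
    case True
    then obtain j t where "j < m" "t \<le> n" "x = pt j t"
      by (auto simp: pverts_H)
    with True show ?thesis
      using pt_eq_iff[of k j "Suc (lo k)" t] k n by (auto simp: pt_in_gaps_iff[OF hi])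
  next
    case False
    then show ?thesis using k n pt_in_pverts[of k "Suc (lo k)"] by auto
  qed
qed

lemma insert_hi_gaps:
  assumes hi: "\<And>k. k < m \<Longrightarrow> hi k \<le> n" and k: "k < m" "Suc (lo k) < hi k"
  shows "insert (pt k (hi k - 1)) (pverts H - gaps lo hi)
    = pverts H - gaps lo (hi(k := hi k - 1))" (is "?L = ?R")
proof (intro set_eqI)
  fix x
  have n: "hi k \<le> n" using hi k(1) .
  define hi' where "hi' = hi(k := hi k - 1)"
  have hi'_le: "hi' j \<le> n" if "j < m" for j
    using hi[OF that] by (auto simp: hi'_def)
  have "x \<in> ?L \<longleftrightarrow> x \<in> pverts H - gaps lo hi'"
  proof (cases "x \<in> pverts H")
    case True
    then obtain j t where "j < m" "t \<le> n" "x = pt j t"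
      by (auto simp: pverts_H)
    with True show ?thesis
      using pt_eq_iff[of k j "hi k - 1" t] k n
      by (auto simp: pt_in_gaps_iff[OF hi] pt_in_gaps_iff[OF hi'_le]) (auto simp: hi'_def split: if_splits)
  next
    case False
    then show ?thesis using k n pt_in_pverts[of k "hi k - 1"] by auto
  qed
  then show "x \<in> ?L \<longleftrightarrow> x \<in> ?R"
    by (simp only: hi'_def)
qed

lemma finite_pverts: "finite (pverts H)"
proof -
  have "pverts H = (\<lambda>(k, t). pt k t) ` ({..<m} \<times> {..n})"
    by (auto simp: pverts_H)
  then show ?thesis by simp
qed

text \<open>Induction on the number of unlabeled vertices. The factorials form the multinomial
  coefficient that interleaves the gaps; within a gap every vertex but the last is taken from either
  of two ends, which gives \<open>2 ^ (a k - 1)\<close>.\<close>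

lemma card_completions_gaps:
  assumes "\<And>k. k < m \<Longrightarrow> lo k < hi k" "\<And>k. k < m \<Longrightarrow> hi k \<le> n"
    and "\<And>k. k < m \<Longrightarrow> a k = hi k - lo k - 1"
  shows "card (completions H (pverts H - gaps lo hi)) * (\<Prod>k<m. fact (a k))
    = fact (\<Sum>k<m. a k) * (\<Prod>k<m. 2 ^ (a k - 1))"
  using assms
proof (induction "\<Sum>k<m. a k" arbitrary: lo hi a)
  case 0
  have a0: "a k = 0" if "k < m" for k
    using 0(1) that by simp
  have "\<not> (lo k < t \<and> t < hi k)" if "k < m" for k t
    using a0[OF that] 0(4)[OF that] by linarith
  then have "gaps lo hi = {}"
    by (auto simp: gaps_def)
  moreover have "prod f {..<m} = 1" if "\<And>k. k < m \<Longrightarrow> f k = 1" for f :: "nat \<Rightarrow> nat"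
    using that by simp
  ultimately show ?case
    using 0(1) a0 by (simp add: completions_pverts)
next
  case (Suc s)
  note lohi = Suc.prems(1) and hi = Suc.prems(2) and a = Suc.prems(3)
  let ?S = "pverts H - gaps lo hi"
  let ?P = "\<Prod>k<m. fact (a k) :: nat"
  let ?Q = "\<Prod>k<m. 2 ^ (a k - 1) :: nat"
  let ?W = "\<lambda>x. card (completions H (insert x ?S))"
  define B where "B k = (if Suc (lo k) < hi k then {pt k (Suc (lo k)), pt k (hi k - 1)} else {})" for k
  have "\<exists>k<m. a k \<noteq> 0"
    using Suc.hyps(2) by (metis lessThan_iff nat.distinct(1) sum.neutral)
  then obtain k where k: "k < m" "a k \<noteq> 0" by blast
  have "pt k (Suc (lo k)) \<in> gaps lo hi" "pt k (Suc (lo k)) \<in> pverts H"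
    using k a[of k] hi[of k] by (auto simp: pt_in_gaps_iff[OF hi] intro!: pt_in_pverts)
  then have "?S \<noteq> pverts H" by blast
  then have "card (completions H ?S) = (\<Sum>x\<in>(\<Union>k<m. B k). ?W x)"
    by (simp add: card_completions_boundary[OF finite_pverts] boundary_gaps[OF hi] B_def)
  also have "\<dots> = (\<Sum>k<m. \<Sum>x\<in>B k. ?W x)"
  proof (rule sum.UNION_disjoint)
    have inner: "\<exists>t. 0 < t \<and> t < n \<and> x = pt i t" if "x \<in> B i" "i < m" for x i
    proof -
      have gap: "Suc (lo i) < hi i" and "x = pt i (Suc (lo i)) \<or> x = pt i (hi i - 1)"
        using that(1) by (auto simp: B_def split: if_splits)
      from this(2) show ?thesis
      proof
        assume "x = pt i (Suc (lo i))"
        with gap hi[OF that(2)] show ?thesis by (intro exI[of _ "Suc (lo i)"]) simp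
      next
        assume "x = pt i (hi i - 1)"
        with gap hi[OF that(2)] show ?thesis by (intro exI[of _ "hi i - 1"]) simp
      qed
    qed
    have "B i \<inter> B j = {}" if "i < m" "j < m" "i \<noteq> j" for i j
    proof -
      have False if x: "x \<in> B i" "x \<in> B j" for x
      proof -
        obtain t t' where "0 < t" "t < n" "x = pt i t" "t' < n" "x = pt j t'"
          using inner[OF x(1) \<open>i < m\<close>] inner[OF x(2) \<open>j < m\<close>] by blast
        with pt_eq_iff[of i j t t'] \<open>i < m\<close> \<open>j < m\<close> \<open>i \<noteq> j\<close> show False by simp
      qed
      then show ?thesis by blast
    qed
    then show "\<forall>i\<in>{..<m}. \<forall>j\<in>{..<m}. i \<noteq> j \<longrightarrow> B i \<inter> B j = {}" by simp
  qed (auto simp: B_def)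
  finally have "card (completions H ?S) * ?P = (\<Sum>k<m. (\<Sum>x\<in>B k. ?W x) * ?P)"
    by (simp add: sum_distrib_right)
  \<comment> \<open>Gap \<open>k\<close> contributes the share \<open>a k\<close>. The shares add up
    to \<open>Suc s\<close>, which turns \<open>fact s\<close> into
    \<open>fact (Suc s)\<close>.\<close>
  also have "\<dots> = (\<Sum>k<m. a k * fact s * ?Q)"
  proof (rule sum.cong[OF refl])
    fix k assume "k \<in> {..<m}"
    then have k: "k < m" by simp
    show "(\<Sum>x\<in>B k. ?W x) * ?P = a k * fact s * ?Q"
    proof (cases "a k = 0")
      case True
      then have "B k = {}" using a[OF k] by (auto simp: B_def)
      with True show ?thesis by simp
    next
      case False
      then have gap: "Suc (lo k) < hi k" using a[OF k] by simp
      have n: "hi k \<le> n" using hi[OF k] .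
      define a' where "a' = a(k := a k - 1)"
      have split: "prod f {..<m} = f k * prod f ({..<m} - {k})" "sum f {..<m} = f k + sum f ({..<m} - {k})"
        for f :: "nat \<Rightarrow> nat"
        using k by (auto intro: prod.remove sum.remove)
      have "(\<Sum>j\<in>{..<m} - {k}. a' j) = (\<Sum>j\<in>{..<m} - {k}. a j)"
        by (intro sum.cong) (auto simp: a'_def)
      then have s: "s = (\<Sum>j<m. a' j)"
        using Suc.hyps(2) False by (simp add: split(2) a'_def)
      have "(\<Prod>j\<in>{..<m} - {k}. fact (a' j)) = (\<Prod>j\<in>{..<m} - {k}. fact (a j) :: nat)"
        by (intro prod.cong) (auto simp: a'_def)
      then have P: "?P = a k * (\<Prod>j<m. fact (a' j))"
        using False by (simp add: split(1) a'_def fact_reduce[of "a k"])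
      have "(\<Prod>j\<in>{..<m} - {k}. 2 ^ (a' j - 1)) = (\<Prod>j\<in>{..<m} - {k}. 2 ^ (a j - 1) :: nat)"
        by (intro prod.cong) (auto simp: a'_def)
      \<comment> \<open>A gap of at least two vertices has two ends, and the exponent drops by one.
        A gap of one vertex has a single end, and truncated subtraction keeps both exponents at
        0.\<close>
      moreover have "(2::nat) ^ (a k - 1) = card (B k) * 2 ^ (a' k - 1)"
      proof (cases "a k = 1")
        case True
        then have "Suc (lo k) = hi k - 1" using a[OF k] by simp
        then have "card (B k) = 1" using gap by (simp add: B_def)
        with True show ?thesis by (simp add: a'_def)
      next
        case *: False
        then have "Suc (lo k) \<noteq> hi k - 1" using False a[OF k] by simp
        then have "card (B k) = 2"
          using gap n k pt_eq_iff[of k k "hi k - 1" "Suc (lo k)"] by (auto simp: B_def)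
        moreover have "a k - 1 = Suc (a' k - 1)" using False * by (simp add: a'_def)
        ultimately show ?thesis by simp
      qed
      ultimately have Q: "?Q = card (B k) * (\<Prod>j<m. 2 ^ (a' j - 1))"
        by (simp add: split(1))
      \<comment> \<open>Taking either end, by raising \<open>lo k\<close> or lowering
        \<open>hi k\<close>, leaves the same gap sizes \<open>a'\<close>, so the induction
        hypothesis gives the same value for both.\<close>
      have W: "?W x * (\<Prod>j<m. fact (a' j)) = fact s * (\<Prod>j<m. 2 ^ (a' j - 1))"
        if "x \<in> B k" for x
      proof -
        from that gap have "x = pt k (Suc (lo k)) \<or> x = pt k (hi k - 1)" by (simp add: B_def)
        then show ?thesis
        proof
          assume x: "x = pt k (Suc (lo k))"
          have "insert x ?S = pverts H - gaps (lo(k := Suc (lo k))) hi"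
            unfolding x using insert_lo_gaps[where hi = hi and lo = lo, OF hi k gap] .
          moreover have "card (completions H (pverts H - gaps (lo(k := Suc (lo k))) hi))
              * (\<Prod>j<m. fact (a' j)) = fact (\<Sum>j<m. a' j) * (\<Prod>j<m. 2 ^ (a' j - 1))"
          proof (rule Suc.hyps(1)[OF s])
            fix j assume j: "j < m"
            show "(lo(k := Suc (lo k))) j < hi j" "hi j \<le> n" "a' j = hi j - (lo(k := Suc (lo k))) j - 1"
              using a[OF j] lohi[OF j] hi[OF j] gap by (auto simp: a'_def)
          qed
          ultimately show ?thesis by (simp only: s)
        next
          assume x: "x = pt k (hi k - 1)"
          have "insert x ?S = pverts H - gaps lo (hi(k := hi k - 1))"
            unfolding x using insert_hi_gaps[where hi = hi and lo = lo, OF hi k gap] .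
          moreover have "card (completions H (pverts H - gaps lo (hi(k := hi k - 1))))
              * (\<Prod>j<m. fact (a' j)) = fact (\<Sum>j<m. a' j) * (\<Prod>j<m. 2 ^ (a' j - 1))"
          proof (rule Suc.hyps(1)[OF s])
            fix j assume j: "j < m"
            show "lo j < (hi(k := hi k - 1)) j" "(hi(k := hi k - 1)) j \<le> n"
              "a' j = (hi(k := hi k - 1)) j - lo j - 1"
              using a[OF j] lohi[OF j] hi[OF j] gap by (auto simp: a'_def)
          qed
          ultimately show ?thesis by (simp only: s)
        qed
      qed
      have "(\<Sum>x\<in>B k. ?W x) * ?P = a k * (\<Sum>x\<in>B k. ?W x * (\<Prod>j<m. fact (a' j)))"
        unfolding P sum_distrib_right[symmetric] by (simp add: ac_simps)
      also have "\<dots> = a k * fact s * ?Q"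
        unfolding Q by (simp add: W)
      finally show ?thesis .
    qed
  qed
  also have "\<dots> = fact (\<Sum>k<m. a k) * ?Q"
    by (simp flip: sum_distrib_right Suc.hyps(2))
  finally show ?case .
qed

section \<open>One partly labeled cycle\<close>

abbreviation M :: nat where "M \<equiv> (m - 1) * (n - 1)"

text \<open>\<open>one_open r\<close> is \<open>fact (n - 1) ^ (m - 1)\<close> times the number of ways to continue when the
  centre is labeled, one cycle has \<open>r\<close> unlabeled vertices and all others have \<open>n - 1\<close>; scaling by
  the factorials avoids division.\<close>

definition scaled_const :: nat where
  "scaled_const = 2 ^ ((m - 1) * (n - 2)) * fact M"

definition one_open :: "nat \<Rightarrow> nat" where
  "one_open r = scaled_const * ((M + r) choose r) * 2 ^ (r - 1)"

lemma card_completions_one_open: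
  assumes k: "k < m" and r: "r = hi k - lo k - 1" "lo k < hi k" "hi k \<le> n"
    and other: "\<And>j. j < m \<Longrightarrow> j \<noteq> k \<Longrightarrow> lo j = 0 \<and> hi j = n"
  shows "card (completions H (pverts H - gaps lo hi)) * fact (n - 1) ^ (m - 1) = one_open r"
    (is "?C * ?D = _")
proof -
  define a where "a j = hi j - lo j - 1" for j
  have a: "a k = r" "\<And>j. j \<in> {..<m} - {k} \<Longrightarrow> a j = n - 1"
    using r other by (auto simp: a_def)
  have card: "card ({..<m} - {k}) = m - 1" using k by simp
  have "?C * (\<Prod>j<m. fact (a j)) = fact (\<Sum>j<m. a j) * (\<Prod>j<m. 2 ^ (a j - 1))"
  proof (rule card_completions_gaps)
    fix j assume j: "j < m"
    show "lo j < hi j" "hi j \<le> n"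
      using r(2,3) other[OF j] n_ge_3 by (cases "j = k"; simp)+
  qed (simp add: a_def)
  moreover have "(\<Prod>j<m. fact (a j)) = fact r * ?D"
  proof -
    have "(\<Prod>j<m. fact (a j)) = fact r * (\<Prod>j\<in>{..<m} - {k}. fact (a j) :: nat)"
      using prod.remove[of "{..<m}" k "\<lambda>j. fact (a j)"] k a(1) by simp
    also have "(\<Prod>j\<in>{..<m} - {k}. fact (a j) :: nat) = (\<Prod>j\<in>{..<m} - {k}. fact (n - 1))"
      by (intro prod.cong refl arg_cong[of _ _ fact] a(2))
    finally show ?thesis using card by (simp only: prod_constant)
  qed
  moreover have "(\<Sum>j<m. a j) = r + M"
  proof -
    have "(\<Sum>j<m. a j) = r + (\<Sum>j\<in>{..<m} - {k}. a j)"
      using sum.remove[of "{..<m}" k a] k a(1) by simp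
    also have "(\<Sum>j\<in>{..<m} - {k}. a j) = (\<Sum>j\<in>{..<m} - {k}. n - 1)"
      by (intro sum.cong refl a(2))
    finally show ?thesis using card by (simp only: sum_constant of_nat_id)
  qed
  moreover have "(\<Prod>j<m. 2 ^ (a j - 1)) = 2 ^ (r - 1) * (2 ^ ((m - 1) * (n - 2)) :: nat)"
  proof -
    have "(\<Prod>j<m. 2 ^ (a j - 1)) = 2 ^ (r - 1) * (\<Prod>j\<in>{..<m} - {k}. 2 ^ (a j - 1) :: nat)"
      using prod.remove[of "{..<m}" k "\<lambda>j. 2 ^ (a j - 1)"] k a(1) by simp
    also have "(\<Prod>j\<in>{..<m} - {k}. 2 ^ (a j - 1) :: nat) = (\<Prod>j\<in>{..<m} - {k}. 2 ^ (n - 2))"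
      by (intro prod.cong refl) (simp add: a(2) numeral_2_eq_2)
    finally show ?thesis
      using card by (simp only: prod_constant power_mult[symmetric] mult.commute)
  qed
  ultimately have *: "?C * (fact r * ?D)
      = fact (r + M) * (2 ^ (r - 1) * 2 ^ ((m - 1) * (n - 2)))"
    by (simp only:)
  \<comment> \<open>The binomial coefficient in \<open>one_open\<close> arises from interleaving the
    \<open>r\<close> vertices of cycle \<open>k\<close> with the \<open>M\<close> vertices of the
    other cycles.\<close>
  have "fact (r + M) = fact r * fact M * ((M + r) choose r)"
    using binomial_fact_lemma[of r "M + r"] by (simp add: add.commute)
  with * have "fact r * (?C * ?D) = fact r * one_open r"
    by (simp only: one_open_def scaled_const_def ac_simps)
  then show ?thesis by (metis fact_nonzero mult_cancel_left)
qed

section \<open>Arcs that avoid the centre\<close>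

text \<open>The labeled vertices while the centre is still unlabeled; \<open>l\<close> and \<open>r\<close> unlabeled vertices
  separate the two ends of the arc from the centre.\<close>

definition arc :: "nat \<Rightarrow> nat \<Rightarrow> nat \<Rightarrow> (nat \<times> nat) option set" where
  "arc k l r = pt k ` {l<..<n - r}"

lemma pt_in_arc_iff:
  assumes "k < m" "t \<le> n"
  shows "pt k t \<in> arc k l r \<longleftrightarrow> l < t \<and> t < n - r"
proof
  assume "pt k t \<in> arc k l r"
  then obtain t' where "l < t'" "t' < n - r" "pt k t = pt k t'"
    by (auto simp: arc_def)
  then show "l < t \<and> t < n - r"
    using pt_eq_iff[of k k t' t] assms by simp
qed (auto simp: arc_def)

lemma None_notin_arc: "k < m \<Longrightarrow> None \<notin> arc k l r"
  using pt_in_arc_iff[of k 0 l r] by simp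

text \<open>The bound on \<open>l + r\<close> says that the arc is nonempty, so it can grow at both
  ends. The two boundary points are distinct unless \<open>l = r = 0\<close>, when both are the
  centre.\<close>

lemma boundary_arc:
  assumes "k < m" "l + r \<le> n - 2"
  shows "boundary H (arc k l r) = {pt k l, pt k (n - r)}"
proof (intro set_eqI iffI)
  fix x assume "x \<in> boundary H (arc k l r)"
  then obtain t where t: "l < t" "t < n - r" and x: "(pt k t, x) \<in> parcs H" "x \<notin> arc k l r"
    by (auto simp: boundary_def arc_def)
  from x(1) have "x = pt k (t - 1) \<or> x = pt k (Suc t)"
    using neighbours_pt(2)[of k t x] assms t by simp
  then show "x \<in> {pt k l, pt k (n - r)}"
  proof
    assume *: "x = pt k (t - 1)"
    moreover have "t - 1 \<le> n" "t - 1 < n - r" "l \<le> t - 1" using t by linarith+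
    ultimately have "t - 1 = l"
      using x(2) pt_in_arc_iff[of k "t - 1" l r] assms(1) by auto
    with * show ?thesis by simp
  next
    assume *: "x = pt k (Suc t)"
    moreover have "Suc t \<le> n" "l < Suc t" "Suc t \<le> n - r" using t by linarith+
    ultimately have "Suc t = n - r"
      using x(2) pt_in_arc_iff[of k "Suc t" l r] assms(1) by auto
    with * show ?thesis by simp
  qed
next
  have n: "Suc l < n - r" using assms(2) n_ge_3 by linarith
  fix x assume "x \<in> {pt k l, pt k (n - r)}"
  then consider "x = pt k l" | "x = pt k (n - r)" by blast
  then show "x \<in> boundary H (arc k l r)"
  proof cases
    case 1
    have "(pt k (Suc l), x) \<in> parcs H" "pt k (Suc l) \<in> arc k l r"
      using neighbours_pt(2)[of k "Suc l" x] assms(1) n 1 by (auto simp: arc_def)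
    then show ?thesis
      using 1 pt_in_arc_iff[of k l l r] pt_in_pverts[of k l] assms(1) n by (auto simp: boundary_def)
  next
    case 2
    define t where "t = n - r - 1"
    have t: "l < t" "t < n - r" "t < n" "Suc t = n - r"
      using n unfolding t_def by linarith+
    then have "(pt k t, x) \<in> parcs H" "pt k t \<in> arc k l r"
      using neighbours_pt(2)[of k t x] pt_in_arc_iff[of k t l r] assms(1) 2 by auto
    then show ?thesis
      using 2 pt_in_arc_iff[of k "n - r" l r] pt_in_pverts[of k "n - r"] assms(1)
      by (auto simp: boundary_def)
  qed
qed

lemma insert_lo_arc: "l < n - r - 1 \<Longrightarrow> insert (pt k (Suc l)) (arc k (Suc l) r) = arc k l r"
proof -
  assume "l < n - r - 1"
  then have "{l<..<n - r} = insert (Suc l) {Suc l<..<n - r}" by auto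
  then show ?thesis by (simp add: arc_def)
qed

lemma insert_hi_arc:
  assumes "l < n - Suc r"
  shows "insert (pt k (n - Suc r)) (arc k l (Suc r)) = arc k l r"
proof -
  have "{l<..<n - r} = insert (n - Suc r) {l<..<n - Suc r}" using assms by auto
  then show ?thesis by (simp add: arc_def)
qed

text \<open>With \<open>l = 0\<close> the centre is next to the arc. Labeling it leaves one gap of
  \<open>r\<close> vertices in cycle \<open>k\<close>, starting after the parameter
  \<open>n - r - 1\<close>, and full gaps elsewhere.\<close>

lemma insert_None_arc_lo:
  assumes "k < m" "r < n"
  shows "insert None (arc k 0 r)
    = pverts H - gaps (\<lambda>j. if j = k then n - r - 1 else 0) (\<lambda>_. n)" (is "?L = _ - gaps ?lo _")
proof (intro set_eqI iffI)
  fix x assume "x \<in> ?L"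
  then consider "x = None" | t where "0 < t" "t < n - r" "x = pt k t"
    by (auto simp: arc_def)
  then show "x \<in> pverts H - gaps ?lo (\<lambda>_. n)"
  proof cases
    case 1
    then show ?thesis using None_notin_gaps[of "\<lambda>_. n" ?lo] None_in_pverts by simp
  next
    case (2 t)
    then show ?thesis
      using pt_in_gaps_iff[of "\<lambda>_. n" k t ?lo] pt_in_pverts[of k t] assms(1) by auto
  qed
next
  fix x assume x: "x \<in> pverts H - gaps ?lo (\<lambda>_. n)"
  then have "x \<in> pverts H" by simp
  then show "x \<in> ?L"
  proof (cases rule: pverts_cases)
    case (2 j t)
    then have "\<not> (?lo j < t \<and> t < n)"
      using x pt_in_gaps_iff[of "\<lambda>_. n" j t ?lo] by auto
    with 2 have "j = k" "t < n - r" by (auto split: if_splits)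
    with 2 show ?thesis by (auto simp: arc_def)
  qed simp
qed

text \<open>The mirror image for \<open>r = 0\<close>: the gap in cycle \<open>k\<close> consists of
  the parameters 1 to \<open>l\<close>, hence ends before \<open>Suc l\<close>.\<close>

lemma insert_None_arc_hi:
  assumes "k < m" "l < n"
  shows "insert None (arc k l 0)
    = pverts H - gaps (\<lambda>_. 0) (\<lambda>j. if j = k then Suc l else n)" (is "?L = _ - gaps _ ?hi")
proof (intro set_eqI iffI)
  have hi: "?hi j \<le> n" for j using assms(2) by simp
  fix x
  {
    assume "x \<in> ?L"
    then consider "x = None" | t where "l < t" "t < n" "x = pt k t"
      by (auto simp: arc_def)
    then show "x \<in> pverts H - gaps (\<lambda>_. 0) ?hi"
    proof cases
      case 1
      then show ?thesis using None_notin_gaps[of ?hi "\<lambda>_. 0"] hi None_in_pverts by simp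
    next
      case (2 t)
      then show ?thesis
        using pt_in_gaps_iff[of ?hi k t "\<lambda>_. 0"] hi pt_in_pverts[of k t] assms(1) by auto
    qed
  next
    assume x: "x \<in> pverts H - gaps (\<lambda>_. 0) ?hi"
    then have "x \<in> pverts H" by simp
    then show "x \<in> ?L"
    proof (cases rule: pverts_cases)
      case (2 j t)
      then have "\<not> (0 < t \<and> t < ?hi j)"
        using x pt_in_gaps_iff[of ?hi j t "\<lambda>_. 0"] hi by auto
      with 2 have "j = k" "l < t" by (auto split: if_splits)
      with 2 show ?thesis by (auto simp: arc_def)
    qed simp
  }
qed

text \<open>Scaled by the same factorial power as \<open>one_open\<close>, so that the two can be
  added.\<close>

abbreviation arc_count :: "nat \<Rightarrow> nat \<Rightarrow> nat \<Rightarrow> nat" where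
  "arc_count k l r \<equiv> card (completions H (arc k l r)) * fact (n - 1) ^ (m - 1)"

text \<open>Growing at the lower end reaches the centre if \<open>l = 0\<close>, which leaves one
  open cycle, and otherwise yields a longer arc.\<close>

lemma insert_lo_count:
  assumes "k < m" "l + r \<le> n - 2"
  shows "card (completions H (insert (pt k l) (arc k l r))) * fact (n - 1) ^ (m - 1)
    = (case l of 0 \<Rightarrow> one_open r | Suc l' \<Rightarrow> arc_count k l' r)"
proof (cases l)
  case 0
  have r: "r < n" using assms(2) n_ge_3 by linarith
  have "card (completions H (pverts H - gaps (\<lambda>j. if j = k then n - r - 1 else 0) (\<lambda>_. n)))
      * fact (n - 1) ^ (m - 1) = one_open r"
    by (rule card_completions_one_open[OF assms(1)]) (use r in auto)
  then show ?thesis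
    using 0 assms(1) insert_None_arc_lo[OF assms(1) r] by simp
next
  case (Suc l')
  with assms(2) n_ge_3 have "l' < n - r - 1" by linarith
  from insert_lo_arc[OF this, of k] Suc show ?thesis by simp
qed

lemma insert_hi_count:
  assumes "k < m" "l + r \<le> n - 2"
  shows "card (completions H (insert (pt k (n - r)) (arc k l r))) * fact (n - 1) ^ (m - 1)
    = (case r of 0 \<Rightarrow> one_open l | Suc r' \<Rightarrow> arc_count k l r')"
proof (cases r)
  case 0
  have l: "l < n" using assms(2) n_ge_3 by linarith
  have "card (completions H (pverts H - gaps (\<lambda>_. 0) (\<lambda>j. if j = k then Suc l else n)))
      * fact (n - 1) ^ (m - 1) = one_open l"
    by (rule card_completions_one_open[OF assms(1)]) (use l in auto)
  then show ?thesis
    using 0 assms(1) insert_None_arc_hi[OF assms(1) l] by simp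
next
  case (Suc r')
  with assms(2) n_ge_3 have "l < n - Suc r'" by linarith
  from insert_hi_arc[OF this, of k] Suc show ?thesis by simp
qed

text \<open>Here both ends of the arc meet the centre, so there is one continuation; the two-term
  recursion would count it twice.\<close>

lemma arc_count_0:
  assumes "k < m"
  shows "arc_count k 0 0 = one_open 0"
proof -
  have "boundary H (arc k 0 0) = {pt k 0}"
    using boundary_arc[of k 0 0] assms by simp
  moreover have "arc k 0 0 \<noteq> pverts H"
    using None_notin_arc[OF assms] None_in_pverts by blast
  ultimately have "card (completions H (arc k 0 0))
      = card (completions H (insert (pt k 0) (arc k 0 0)))"
    by (simp add: card_completions_boundary[OF finite_pverts])
  then show ?thesis
    using insert_lo_count[of k 0 0] assms by simp
qed

lemma arc_count_rec:
  assumes "k < m" "l + r \<le> n - 2" "0 < l + r"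
  shows "arc_count k l r
    = (case l of 0 \<Rightarrow> one_open r | Suc l' \<Rightarrow> arc_count k l' r)
    + (case r of 0 \<Rightarrow> one_open l | Suc r' \<Rightarrow> arc_count k l r')"
proof -
  have lr: "l < n - r" "l < n" using assms(2) n_ge_3 by linarith+
  \<comment> \<open>Since \<open>0 < l + r\<close>, at least one of the two points is an inner
    vertex, as \<open>pt_eq_iff\<close> requires; the case split selects which.\<close>
  have "pt k l \<noteq> pt k (n - r)"
  proof (cases "l = 0")
    case True
    then show ?thesis
      using pt_eq_iff[of k k "n - r" l] assms lr by auto
  next
    case False
    then show ?thesis
      using pt_eq_iff[of k k l "n - r"] assms lr by auto
  qed
  moreover have "arc k l r \<noteq> pverts H"
    using None_notin_arc[OF assms(1)] None_in_pverts by blast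
  ultimately have "card (completions H (arc k l r))
      = card (completions H (insert (pt k l) (arc k l r)))
      + card (completions H (insert (pt k (n - r)) (arc k l r)))"
    by (simp add: card_completions_boundary[OF finite_pverts] boundary_arc[OF assms(1,2)])
  then show ?thesis
    by (simp only: add_mult_distrib insert_lo_count[OF assms(1,2)] insert_hi_count[OF assms(1,2)])
qed

text \<open>Summing over all arcs of the same length makes the recursion one-dimensional: the two
  neighbours of an arc contribute the same sum, so that the total \<open>T s\<close> over \<open>l + r = s\<close> satisfies
  \<open>T (s + 1) = 2 * T s + 2 * one_open (s + 1)\<close>.\<close>

lemma sum_arc_count:
  assumes "k < m" "s \<le> n - 2"
  shows "(\<Sum>l\<le>s. arc_count k l (s - l)) = 2 ^ s * scaled_const * ((M + s + 1) choose s)"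
  using assms(2)
proof (induction s)
  case 0
  then show ?case
    using arc_count_0[OF assms(1)] by (simp add: one_open_def)
next
  case (Suc s)
  let ?T = "\<Sum>l\<le>s. arc_count k l (s - l)"
  have "(\<Sum>l\<le>Suc s. arc_count k l (Suc s - l))
      = (\<Sum>l\<le>Suc s. case l of 0 \<Rightarrow> one_open (Suc s - l) | Suc l' \<Rightarrow> arc_count k l' (Suc s - l))
      + (\<Sum>l\<le>Suc s. case Suc s - l of 0 \<Rightarrow> one_open l | Suc r' \<Rightarrow> arc_count k l r')"
    unfolding sum.distrib[symmetric]
    by (intro sum.cong refl arc_count_rec assms(1)) (use Suc.prems in auto)
  \<comment> \<open>Splitting off \<open>l = 0\<close>, where the centre gets labeled, and shifting
    the index leaves the total for \<open>s\<close>.\<close>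
  also have "(\<Sum>l\<le>Suc s. case l of 0 \<Rightarrow> one_open (Suc s - l) | Suc l' \<Rightarrow> arc_count k l' (Suc s - l))
      = one_open (Suc s) + ?T"
    unfolding sum.atMost_Suc_shift by simp
  also have "(\<Sum>l\<le>Suc s. case Suc s - l of 0 \<Rightarrow> one_open l | Suc r' \<Rightarrow> arc_count k l r')
      = ?T + one_open (Suc s)"
  proof -
    have "(\<Sum>l\<le>s. case Suc s - l of 0 \<Rightarrow> one_open l | Suc r' \<Rightarrow> arc_count k l r') = ?T"
      by (intro sum.cong) (auto simp: Suc_diff_le)
    then show ?thesis by simp
  qed
  also have "one_open (Suc s) + ?T + (?T + one_open (Suc s)) = 2 * ?T + 2 * one_open (Suc s)"
    by simp
  also have "?T = 2 ^ s * scaled_const * ((M + s + 1) choose s)"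
    using Suc by simp
  \<comment> \<open>The factor \<open>2 ^ s\<close> in \<open>one_open (Suc s)\<close> matches that
    of the total, so Pascal's rule completes the step.\<close>
  also have "2 * (2 ^ s * scaled_const * ((M + s + 1) choose s)) + 2 * one_open (Suc s)
      = 2 ^ Suc s * scaled_const * (((M + s + 1) choose s) + ((M + s + 1) choose Suc s))"
    by (simp add: one_open_def add_mult_distrib2 ac_simps)
  also have "((M + s + 1) choose s) + ((M + s + 1) choose Suc s) = (M + Suc s + 1) choose Suc s"
    by simp
  finally show ?case .
qed

section \<open>Summing over all starting vertices\<close>

lemma singleton_None_eq: "{None} = pverts H - gaps (\<lambda>_. 0) (\<lambda>_. n)"
proof (intro set_eqI iffI)
  fix x :: "(nat \<times> nat) option"
  assume "x \<in> {None}"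
  then show "x \<in> pverts H - gaps (\<lambda>_. 0) (\<lambda>_. n)"
    using None_notin_gaps[of "\<lambda>_. n" "\<lambda>_. 0"] None_in_pverts by simp
next
  fix x assume x: "x \<in> pverts H - gaps (\<lambda>_. 0) (\<lambda>_. n)"
  then have "x \<in> pverts H" by simp
  then show "x \<in> {None}"
    by (cases rule: pverts_cases) (use x in \<open>auto simp: gaps_def\<close>)
qed

text \<open>Writing inner parameters as \<open>Suc l\<close> with \<open>l \<le> n - 2\<close> makes
  \<open>l\<close> the number of vertices before the starting vertex, which matches the arc
  sums.\<close>

lemma sum_pverts:
  "(\<Sum>v\<in>pverts H. f v) = f None + (\<Sum>k<m. \<Sum>l\<le>n - 2. f (pt k (Suc l)))"
proof -
  let ?I = "{..<m} \<times> {..n - 2}"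
  let ?g = "\<lambda>(k, l). pt k (Suc l)"
  have inner: "l \<le> n - 2 \<longleftrightarrow> Suc l < n" for l using n_ge_3 by auto
  have V: "pverts H = insert None (?g ` ?I)"
  proof (intro set_eqI iffI)
    fix x assume "x \<in> pverts H"
    then show "x \<in> insert None (?g ` ?I)"
    proof (cases rule: pverts_cases)
      case (2 k t)
      then have "x = ?g (k, t - 1)" "(k, t - 1) \<in> ?I" by auto
      then show ?thesis by blast
    qed simp
  qed (use None_in_pverts inner in \<open>auto intro!: pt_in_pverts\<close>)
  have "inj_on ?g ?I"
  proof (rule inj_onI, clarify)
    fix k l k' l' assume "pt k (Suc l) = pt k' (Suc l')" "k < m" "k' < m" "l \<le> n - 2" "l' \<le> n - 2"
    then show "k = k' \<and> l = l'"
      using pt_eq_iff[of k' k "Suc l'" "Suc l"] inner[of l] inner[of l'] by simp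
  qed
  moreover have "None \<notin> ?g ` ?I"
    using inner by (auto simp: pt_inner)
  ultimately show ?thesis
    unfolding V by (simp add: sum.reindex sum.cartesian_product case_prod_unfold)
qed

lemma num_rw_labelings_mult:
  "\<L> H * fact (n - 1) ^ (m - 1) = (2 ^ (n - 2)) ^ m * fact M
    * ((m * (n - 1) choose (n - 1)) + m * (m * (n - 1) choose (n - 2)))"
proof -
  note L = pair_graph.num_rw_labelings_eq[OF pair_graph_cycle_union[OF n_ge_3]]
  let ?D = "fact (n - 1) ^ (m - 1) :: nat"
  have mn: "M + (n - 1) = m * (n - 1)"
    using m_pos by (cases m) auto
  have N: "n - 1 - 1 = n - 2" by simp
  \<comment> \<open>From the centre all cycles are fully open; cycle 0 serves as the distinguished
    one, with \<open>r = n - 1\<close>.\<close>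
  have None: "card (completions H {None}) * ?D = one_open (n - 1)"
    unfolding singleton_None_eq
    by (rule card_completions_one_open[of 0]) (use m_pos n_ge_3 in auto)
  \<comment> \<open>A single inner vertex is an arc whose two distances \<open>l\<close> and
    \<open>n - 2 - l\<close> add up to \<open>n - 2\<close>, so \<open>sum_arc_count\<close> applies
    with \<open>s = n - 2\<close>.\<close>
  have arc: "{pt k (Suc l)} = arc k l (n - 2 - l)" if "l \<le> n - 2" for k l
  proof -
    have "{l<..<n - (n - 2 - l)} = {Suc l}" using that n_ge_3 by auto
    then show ?thesis by (simp add: arc_def)
  qed
  have "(\<Sum>l\<le>n - 2. card (completions H {pt k (Suc l)}) * ?D)
      = 2 ^ (n - 2) * scaled_const * (m * (n - 1) choose (n - 2))" if "k < m" for k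
  proof -
    have "(\<Sum>l\<le>n - 2. card (completions H {pt k (Suc l)}) * ?D)
        = (\<Sum>l\<le>n - 2. arc_count k l (n - 2 - l))"
      by (intro sum.cong refl) (simp only: arc atMost_iff)
    also have "\<dots> = 2 ^ (n - 2) * scaled_const * ((M + (n - 2) + 1) choose (n - 2))"
      using that by (intro sum_arc_count) auto
    also have "M + (n - 2) + 1 = m * (n - 1)"
      using mn n_ge_3 by linarith
    finally show ?thesis .
  qed
  then have "(\<Sum>k<m. \<Sum>l\<le>n - 2. card (completions H {pt k (Suc l)}) * ?D)
      = m * (2 ^ (n - 2) * scaled_const * (m * (n - 1) choose (n - 2)))"
    by simp
  then have "\<L> H * ?D = one_open (n - 1)
      + m * (2 ^ (n - 2) * scaled_const * (m * (n - 1) choose (n - 2)))"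
    by (simp only: L sum_pverts add_mult_distrib sum_distrib_right None)
  also have "\<dots> = 2 ^ (n - 2) * scaled_const
      * ((m * (n - 1) choose (n - 1)) + m * (m * (n - 1) choose (n - 2)))"
    unfolding one_open_def mn N by (simp add: add_mult_distrib2 ac_simps)
  also have "2 ^ (n - 2) * scaled_const = (2 ^ (n - 2)) ^ m * fact M"
    using m_pos unfolding scaled_const_def power_mult[symmetric]
    by (cases m) (simp_all add: power_add ac_simps)
  finally show ?thesis .
qed

end

section \<open>Passing to the multinomial coefficient\<close>

lemma multinomial_replicate:
  "multinomial (r * a) (replicate r a) * fact a ^ r = fact (r * a)"
proof -
  have "prod_list (map fact (replicate r a)) = (fact a ^ r :: nat)"
    by (simp add: prod_list_replicate)
  \<comment> \<open>Divisibility makes the \<open>div\<close> in \<open>multinomial\<close>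
    exact.\<close>
  with prod_list_fact_dvd[of "replicate r a"] show ?thesis
    by (simp add: multinomial_def sum_list_replicate)
qed

theorem theorem7:
  fixes m n :: nat and b :: "nat \<Rightarrow> nat"
  assumes "m \<ge> 1" and "n \<ge> 3"
    and "\<And>k. k < m \<Longrightarrow> b k < n"
  shows "\<L> (cycle_union n m b) =
    (2 ^ (n - 2)) ^ m * multinomial ((m - 1) * (n - 1)) (replicate (m - 1) (n - 1))
      * ((m * (n - 1) choose (n - 1)) + m * (m * (n - 1) choose (n - 2)))"
proof -
  interpret cycle_coordinates m n b
    using assms by unfold_locales
  let ?D = "fact (n - 1) ^ (m - 1) :: nat"
  \<comment> \<open>Replacing \<open>fact M\<close> by the multinomial coefficient times
    \<open>?D\<close> puts the nonzero factor \<open>?D\<close> on both sides, where it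
    cancels.\<close>
  have "\<L> (cycle_union n m b) * ?D =
    ((2 ^ (n - 2)) ^ m * multinomial ((m - 1) * (n - 1)) (replicate (m - 1) (n - 1))
      * ((m * (n - 1) choose (n - 1)) + m * (m * (n - 1) choose (n - 2)))) * ?D"
    unfolding num_rw_labelings_mult
      multinomial_replicate[of "m - 1" "n - 1", symmetric]
    by (simp only: ac_simps)
  then show ?thesis by simp
qed

end
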